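(* Suppose single-shot SBFT, with fast-path timeout function $F_f$, is run with a synchronizer satisfying the specification (P1)-(P5) given in the context for some view $\mathcal V$ and $d=2\delta$. Assume that for every $\theta$ there is a view $v$ such that for all $v'\ge v$: $F(v')>\theta$, $F_f(v')>\theta$ and $F(v')-F_f(v')>\theta$. Then all correct processes eventually decide.
   Context: Model. There are $n=3f+1$ processes $\mathcal P=\{p_1,\dots,p_n\}$, at most $f$ of which are faulty (Byzantine, behaving arbitrarily); the others are correct. A quorum is a set of $2f+1$ processes. Processes communicate over authenticated point-to-point links. Partial synchrony: there are a time $\mathsf{GST}$ and a bound $\delta$, both unknown to the protocol, such that after $\mathsf{GST}$ messages between correct processes are delayed by at most $\delta$; before $\mathsf{GST}$ messages may be arbitrarily delayed or lost (self-addressed messages are never lost). Local clocks may drift unboundedly before $\mathsf{GST}$ and do not drift from real time after it. Local processing takes zero time. $\langle m\rangle_i$ denotes $m$ signed by $p_i$; signatures are unforgeable and $\mathsf{hash}$ is collision-resistant (both idealized as perfect). Each correct process has a proposal $\mathtt{myval}()$ satisfying a given predicate $\mathsf{valid}$. Synchronizer. Views are $1,2,\dots$; $0$ denotes an invalid view. A synchronizer issues notifications $\mathtt{new\_view}(v)$ at each correct process, which then enters $v$ and stays in it until it enters another view. Each correct process eventually calls the synchronizer's function $\mathtt{start}()$. The timeout function $F:\{0,1,2,\dots\}\to\mathsf{Time}$ is monotone with $F(0)=0$. $E_i(v)$ is the time when correct $p_i$ enters $v$; $E_{\rm first}(v)$, $E_{\rm last}(v)$ are the earliest and latest times when some correct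 process enters $v$. Specification, for a view $\mathcal V$: (P1) if $v<v'$ and $E_i(v),E_i(v')$ are defined then $E_i(v)<E_i(v')$; (P2) $E_{\rm first}(\mathcal V)\ge\mathsf{GST}$; (P3) every correct process enters every $v\ge\mathcal V$; (P4) $E_{\rm last}(v)\le E_{\rm first}(v)+d$ for all $v\ge\mathcal V$; (P5) $E_{\rm first}(v+1)\ge E_{\rm first}(v)+F(v)$ for all $v\ge\mathcal V$. Single-shot (all-to-all) SBFT (code of $p_i$), with fast-path timeout function $F_f$. $\mathsf{leader}(v)=p_{((v-1)\bmod n)+1}$. Variables $\mathsf{curr\_view},\mathsf{locked\_view},\mathsf{pre\_view}$ are initially $0$; $\mathsf{curr\_val},\mathsf{prepared\_val},\mathsf{cert},\mathsf{voted}$ are initially $\bot$; $\mathsf{timer\_fast\_path}$ is a timer. A handler runs when its trigger and precondition hold; messages for views higher than the current one are buffered (for each type and sender, only the one with the highest view is kept). "All" includes the sender. 1. Upon $\mathtt{new\_view}(v)$: $\mathsf{curr\_view}:=v$; $\mathsf{voted}:=$ false; send $\langle\mathtt{NEWLEADER}(v,\mathsf{locked\_view},\mathsf{prepared\_val},\mathsf{cert},\mathsf{pre\_view},\mathsf{curr\_val})\rangle_i$ to $\mathsf{leader}(v)$. 2. (Once per view.) When messages $M=\{\langle\mathtt{NEWLEADER}(v,view_j,val_j,cert_j,pre_j,cur_j)\rangle_j\mid p_j\in Q\}$ are received for a quorum $Q$, with $\mathsf{curr\_view}=v$, $p_i=\mathsf{leader}(v)$ and ValidNewLeader$(m)$ for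 all $m\in M$: compute $(x_{\rm slow},v_{\rm slow},x_{\rm fast},v_{\rm fast})$ by the Selection rule below; if $v_{\rm slow}\ge v_{\rm fast}$ and $v_{\rm slow}>0$, send $\langle\mathtt{PROPOSE}(v,x_{\rm slow},M)\rangle_i$ to all; else if $v_{\rm fast}>v_{\rm slow}$, send $\langle\mathtt{PROPOSE}(v,x_{\rm fast},M)\rangle_i$ to all; else send $\langle\mathtt{PROPOSE}(v,\mathtt{myval}(),M)\rangle_i$ to all. 3. When $m=\langle\mathtt{PROPOSE}(v,x,\_)\rangle_j$ is received, with $\mathsf{curr\_view}=v$, $\mathsf{voted}=$ false, SafeProposal$(m)$: $\mathsf{curr\_val}:=x$; $\mathsf{pre\_view}:=v$; $\mathsf{voted}:=$ true; stop $\mathsf{timer\_fast\_path}$ and start it with duration $F_f(v)$; send $\langle\mathtt{PREPARED}(v,\mathsf{hash}(x))\rangle_i$ to all. 4. (Fast path.) When $\{\langle\mathtt{PREPARED}(v,h)\rangle_j\mid p_j\in\mathcal P\}$ (from all processes) is received, with $\mathsf{curr\_view}=v$, $\mathsf{voted}=$ true, $\mathsf{hash}(\mathsf{curr\_val})=h$: decide $\mathsf{curr\_val}$. 5. When $\mathsf{timer\_fast\_path}$ has expired and $C=\{\langle\mathtt{PREPARED}(v,h)\rangle_j\mid p_j\in Q\}$ has been received for at least a quorum $Q$, with $\mathsf{curr\_view}=v$, $\mathsf{voted}=$ true, $\mathsf{hash}(\mathsf{curr\_val})=h$: $\mathsf{prepared\_val}:=\mathsf{curr\_val}$; $\mathsf{locked\_view}:=v$;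 $\mathsf{cert}:=C$; send $\langle\mathtt{COMMITTED}(v,h)\rangle_i$ to all. 6. When $\{\langle\mathtt{COMMITTED}(v,h)\rangle_j\mid p_j\in Q\}$ is received for a quorum $Q$, with $\mathsf{curr\_view}=\mathsf{locked\_view}=v$, $\mathsf{hash}(\mathsf{curr\_val})=h$: decide $\mathsf{curr\_val}$. Selection rule. $(x_{\rm slow},v_{\rm slow})=(val_j,view_j)$ for some $j$ with $view_j=\max\{view_k\mid p_k\in Q\}$ if this maximum is nonzero, else $(\bot,0)$. Let $D$ be the set of pairs $(x,u)$ for which there is $P\subseteq Q$ with $|P|=f+1$, $cur_j=x$ for all $p_j\in P$, and $u=\min\{pre_j\mid p_j\in P\}$. Let $u^*=\max\{u\mid(\_,u)\in D\}$; if there is exactly one $x$ with $(x,u^* )\in D$, then $(x_{\rm fast},v_{\rm fast})=(x,u^* )$; otherwise (including $D=\emptyset$) $(x_{\rm fast},v_{\rm fast})=(\bot,0)$. View-1 optimization: in view $1$ the leader proposes $\mathtt{myval}()$ immediately on entering, without waiting for $\mathtt{NEWLEADER}$ messages (which need not be sent to it), and SafeProposal for view $1$ only requires that the sender is $\mathsf{leader}(1)$ and the value is valid. Predicates: prepared$(C,v,h)$ iff $C=\{\langle\mathtt{PREPARED}(v,h)\rangle_j\mid p_j\in Q\}$ for some quorum $Q$ (a certificate with more than $2f+1$ messages is also accepted). ValidNewLeader$(\langle\mathtt{NEWLEADER}(v',v,x,C,v_0,x_0)\rangle_{\_})$ iff $v\le v_0<v'$ and ($v\ne0$ implies prepared$(C,v,\mathsf{hash}(x))$).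 SafeProposal$(\langle\mathtt{PROPOSE}(v,x,M)\rangle_i)$ iff $p_i=\mathsf{leader}(v)$, $\mathsf{valid}(x)$, $M$ is a set of $\mathtt{NEWLEADER}$ messages for view $v$ signed by the members of some quorum $Q$, all satisfying ValidNewLeader, and for $v_{\rm slow},v_{\rm fast},x_{\rm slow},x_{\rm fast}$ computed from $M$ by the Selection rule: ($v_{\rm slow}\ge v_{\rm fast}$ and $v_{\rm slow}>0$ imply $x=x_{\rm slow}$) and ($v_{\rm slow}<v_{\rm fast}$ implies $x=x_{\rm fast}$). *)

theory Defs
  imports Complex_Main
begin

type_synonym proc = nat
type_synonym view = nat

(* The bottom value is None; views are positive and 0 is the invalid view.
   Every message carries the identity of the process that signed it. *)

datatype 'h prepared_msg = PreparedMsg (pm_signer: proc) (pm_view: view) (pm_hash: 'h)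

datatype ('v, 'h) newleader_msg = NewLeaderMsg
  (nl_signer: proc) (nl_view: view)
  (nl_locked_view: view) (nl_prepared_val: "'v option")
  (nl_cert: "'h prepared_msg set option")
  (nl_pre_view: view) (nl_curr_val: "'v option")

datatype ('v, 'h) msg =
    NEWLEADER "('v, 'h) newleader_msg"
  | PROPOSE proc view "'v option" "('v, 'h) newleader_msg set"
  | PREPARED "'h prepared_msg"
  | COMMITTED proc view 'h

datatype msg_kind = K_newleader | K_propose | K_prepared | K_committed

fun kind :: "('v, 'h) msg \<Rightarrow> msg_kind" where
  "kind (NEWLEADER l) = K_newleader"
| "kind (PROPOSE j v x M) = K_propose"
| "kind (PREPARED c) = K_prepared"
| "kind (COMMITTED j v h) = K_committed"

fun signer :: "('v, 'h) msg \<Rightarrow> proc" where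
  "signer (NEWLEADER l) = nl_signer l"
| "signer (PROPOSE j v x M) = j"
| "signer (PREPARED c) = pm_signer c"
| "signer (COMMITTED j v h) = j"

fun msg_view :: "('v, 'h) msg \<Rightarrow> view" where
  "msg_view (NEWLEADER l) = nl_view l"
| "msg_view (PROPOSE j v x M) = v"
| "msg_view (PREPARED c) = pm_view c"
| "msg_view (COMMITTED j v h) = v"

(* All signed messages occurring in a message, including itself. *)

definition newleader_parts :: "('v, 'h) newleader_msg \<Rightarrow> ('v, 'h) msg set" where
  "newleader_parts l = insert (NEWLEADER l)
     (case nl_cert l of None \<Rightarrow> {} | Some C \<Rightarrow> PREPARED ` C)"

fun signed_parts :: "('v, 'h) msg \<Rightarrow> ('v, 'h) msg set" where
  "signed_parts (NEWLEADER l) = newleader_parts l"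
| "signed_parts (PROPOSE j v x M) = insert (PROPOSE j v x M) (\<Union>l\<in>M. newleader_parts l)"
| "signed_parts (PREPARED c) = {PREPARED c}"
| "signed_parts (COMMITTED j v h) = {COMMITTED j v h}"

(* Beyond the variables of the code: timer is the local-clock reading at which the timer expires
   (None: not started); proposed records that the leader has already proposed in the
   current view; received holds the received and buffered messages; decisions collects the
   decided values together with the view of the decision. *)

record ('v, 'h) local_state =
  curr_view :: view
  locked_view :: view
  pre_view :: view
  curr_val :: "'v option"
  prepared_val :: "'v option"
  cert :: "'h prepared_msg set option"
  voted :: "bool option"
  timer :: "real option"
  proposed :: bool
  received :: "('v, 'h) msg set"
  decisions :: "(view \<times> 'v option) set"

definition init_state :: "('v, 'h) local_state" where
  "init_state = \<lparr>curr_view = 0, locked_view = 0, pre_view = 0,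
     curr_val = None, prepared_val = None, cert = None, voted = None,
     timer = None, proposed = False, received = {}, decisions = {}\<rparr>"

(* Among the messages for views above the current one, only one per kind and signer, with the
   highest view, is kept (the earlier one if the views are equal). *)

definition store :: "('v, 'h) msg \<Rightarrow> ('v, 'h) local_state \<Rightarrow> ('v, 'h) msg set" where
  "store m s =
    (let same = {m' \<in> received s. kind m' = kind m \<and> signer m' = signer m \<and>
                   msg_view m' > curr_view s}
     in if msg_view m \<le> curr_view s then insert m (received s)
        else if \<exists>m'\<in>same. msg_view m \<le> msg_view m' then received s
        else insert m (received s - same))"

(* Deliver q p m: p receives m over its link from q. The five events after it are executions
   of the message and timer handlers, with the nondeterministic choices as arguments.
   Other: anything that does not involve a correct process. *)

datatype ('v, 'h) event =
    Start proc
  | NewView proc view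
  | Deliver proc proc "('v, 'h) msg"
  | Propose proc "('v, 'h) newleader_msg set" "'v option"
  | Vote proc "('v, 'h) msg"
  | FastDecide proc
  | Lock proc "'h prepared_msg set"
  | SlowDecide proc
  | Other

fun actor :: "('v, 'h) event \<Rightarrow> proc option" where
  "actor (Start p) = Some p"
| "actor (NewView p v) = Some p"
| "actor (Deliver q p m) = Some p"
| "actor (Propose p M x) = Some p"
| "actor (Vote p m) = Some p"
| "actor (FastDecide p) = Some p"
| "actor (Lock p C) = Some p"
| "actor (SlowDecide p) = Some p"
| "actor Other = None"

locale sbft =
  fixes f :: nat
    and valid :: "'v \<Rightarrow> bool"
    and myval :: "proc \<Rightarrow> 'v"
    and hash :: "'v option \<Rightarrow> 'h"
    and Ff :: "view \<Rightarrow> real"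
  assumes hash_perfect: "inj hash"
    and Ff_nonneg: "0 \<le> Ff v"
begin

definition procs :: "proc set" where
  "procs = {1..3 * f + 1}"

definition leader :: "view \<Rightarrow> proc" where
  "leader v = (v - 1) mod (3 * f + 1) + 1"

definition quorum :: "proc set \<Rightarrow> bool" where
  "quorum Q \<longleftrightarrow> Q \<subseteq> procs \<and> card Q = 2 * f + 1"

definition certifies :: "'h prepared_msg set \<Rightarrow> view \<Rightarrow> 'h \<Rightarrow> bool" where
  "certifies C v h \<longleftrightarrow>
     (\<exists>Q\<subseteq>procs. 2 * f + 1 \<le> card Q \<and> C = {PreparedMsg j v h | j. j \<in> Q})"

definition prepared :: "'h prepared_msg set option \<Rightarrow> view \<Rightarrow> 'h \<Rightarrow> bool" where
  "prepared c v h \<longleftrightarrow> (\<exists>C. c = Some C \<and> certifies C v h)"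

definition valid_new_leader :: "('v, 'h) newleader_msg \<Rightarrow> bool" where
  "valid_new_leader l \<longleftrightarrow>
     nl_locked_view l \<le> nl_pre_view l \<and> nl_pre_view l < nl_view l \<and>
     (nl_locked_view l \<noteq> 0 \<longrightarrow>
        prepared (nl_cert l) (nl_locked_view l) (hash (nl_prepared_val l)))"

definition newleader_quorum :: "view \<Rightarrow> ('v, 'h) newleader_msg set \<Rightarrow> bool" where
  "newleader_quorum v M \<longleftrightarrow>
     (\<exists>Q. quorum Q \<and> bij_betw nl_signer M Q) \<and>
     (\<forall>l\<in>M. nl_view l = v \<and> valid_new_leader l)"

(* The slow part of the selection may pick any message with the highest locked view, hence it is
   a relation; the fast part is a function. *)

definition slow_choice :: "('v, 'h) newleader_msg set \<Rightarrow> 'v option \<Rightarrow> view \<Rightarrow> bool" where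
  "slow_choice M x u \<longleftrightarrow>
     (let w = Max (nl_locked_view ` M)
      in if w \<noteq> 0 then u = w \<and> (\<exists>l\<in>M. nl_locked_view l = w \<and> x = nl_prepared_val l)
         else x = None \<and> u = 0)"

definition fast_candidates :: "('v, 'h) newleader_msg set \<Rightarrow> ('v option \<times> view) set" where
  "fast_candidates M =
     {(x, u). \<exists>P\<subseteq>M. card P = f + 1 \<and> (\<forall>l\<in>P. nl_curr_val l = x) \<and> u = Min (nl_pre_view ` P)}"

definition fast_choice :: "('v, 'h) newleader_msg set \<Rightarrow> 'v option \<times> view" where
  "fast_choice M =
     (let D = fast_candidates M; u = Max (snd ` D)
      in if D \<noteq> {} \<and> (\<exists>!x. (x, u) \<in> D) then (THE x. (x, u) \<in> D, u) else (None, 0))"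

definition selection ::
  "('v, 'h) newleader_msg set \<Rightarrow> 'v option \<Rightarrow> view \<Rightarrow> 'v option \<Rightarrow> view \<Rightarrow> bool" where
  "selection M x_slow v_slow x_fast v_fast \<longleftrightarrow>
     slow_choice M x_slow v_slow \<and> (x_fast, v_fast) = fast_choice M"

definition leader_choice :: "proc \<Rightarrow> ('v, 'h) newleader_msg set \<Rightarrow> 'v option \<Rightarrow> bool" where
  "leader_choice p M x \<longleftrightarrow>
     (\<exists>x_slow v_slow x_fast v_fast. selection M x_slow v_slow x_fast v_fast \<and>
        x = (if v_slow \<ge> v_fast \<and> v_slow > 0 then x_slow
             else if v_fast > v_slow then x_fast
             else Some (myval p)))"

fun safe_proposal :: "('v, 'h) msg \<Rightarrow> bool" where
  "safe_proposal (PROPOSE i v x M) \<longleftrightarrow>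
     i = leader v \<and> (\<exists>y. x = Some y \<and> valid y) \<and>
     (v = 1 \<or>
      newleader_quorum v M \<and>
      (\<exists>x_slow v_slow x_fast v_fast. selection M x_slow v_slow x_fast v_fast \<and>
         (v_slow \<ge> v_fast \<and> v_slow > 0 \<longrightarrow> x = x_slow) \<and>
         (v_slow < v_fast \<longrightarrow> x = x_fast)))"
| "safe_proposal _ \<longleftrightarrow> False"

(* In the next three functions, c is the reading of the local clock. *)

definition timer_expired :: "real \<Rightarrow> ('v, 'h) local_state \<Rightarrow> bool" where
  "timer_expired c s \<longleftrightarrow> (\<exists>e. timer s = Some e \<and> e \<le> c)"

fun enabled :: "real \<Rightarrow> ('v, 'h) local_state \<Rightarrow> ('v, 'h) event \<Rightarrow> bool" where
  "enabled c s (Start p) \<longleftrightarrow> True"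
| "enabled c s (NewView p v) \<longleftrightarrow> v \<ge> 1"
| "enabled c s (Deliver q p m) \<longleftrightarrow> True"
| "enabled c s (Propose p M x) \<longleftrightarrow>
     curr_view s > 1 \<and> p = leader (curr_view s) \<and> \<not> proposed s \<and>
     NEWLEADER ` M \<subseteq> received s \<and> newleader_quorum (curr_view s) M \<and>
     leader_choice p M x"
| "enabled c s (Vote p m) \<longleftrightarrow>
     m \<in> received s \<and> msg_view m = curr_view s \<and> voted s = Some False \<and> safe_proposal m"
| "enabled c s (FastDecide p) \<longleftrightarrow>
     (\<forall>j\<in>procs. PREPARED (PreparedMsg j (curr_view s) (hash (curr_val s))) \<in> received s) \<and>
     voted s = Some True"
| "enabled c s (Lock p C) \<longleftrightarrow>
     timer_expired c s \<and> PREPARED ` C \<subseteq> received s \<and>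
     certifies C (curr_view s) (hash (curr_val s)) \<and> voted s = Some True"
| "enabled c s (SlowDecide p) \<longleftrightarrow>
     (\<exists>Q. quorum Q \<and>
        (\<forall>j\<in>Q. COMMITTED j (curr_view s) (hash (curr_val s)) \<in> received s)) \<and>
     locked_view s = curr_view s"
| "enabled c s Other \<longleftrightarrow> True"

fun effect :: "real \<Rightarrow> ('v, 'h) event \<Rightarrow> ('v, 'h) local_state \<Rightarrow> ('v, 'h) local_state" where
  "effect c (Start p) s = s"
| "effect c (NewView p v) s =
     s\<lparr>curr_view := v, voted := Some False, proposed := False\<rparr>"
| "effect c (Deliver q p m) s = s\<lparr>received := store m s\<rparr>"
| "effect c (Propose p M x) s = s\<lparr>proposed := True\<rparr>"
| "effect c (Vote p m) s =
     (case m of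
        PROPOSE j v x M \<Rightarrow>
          s\<lparr>curr_val := x, pre_view := v, voted := Some True, timer := Some (c + Ff v)\<rparr>
      | _ \<Rightarrow> s)"
| "effect c (FastDecide p) s =
     s\<lparr>decisions := insert (curr_view s, curr_val s) (decisions s)\<rparr>"
| "effect c (Lock p C) s =
     s\<lparr>prepared_val := curr_val s, locked_view := curr_view s, cert := Some C\<rparr>"
| "effect c (SlowDecide p) s =
     s\<lparr>decisions := insert (curr_view s, curr_val s) (decisions s)\<rparr>"
| "effect c Other s = s"

definition to_all :: "('v, 'h) msg \<Rightarrow> (proc \<times> ('v, 'h) msg) set" where
  "to_all m = {(q, m) | q. q \<in> procs}"

(* The (destination, message) pairs sent by an event executed in state s. In view 1 no NEWLEADER
   is sent and the leader proposes upon entering. *)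

fun sends :: "('v, 'h) event \<Rightarrow> ('v, 'h) local_state \<Rightarrow> (proc \<times> ('v, 'h) msg) set" where
  "sends (NewView p v) s =
     (if v = 1 then (if p = leader 1 then to_all (PROPOSE p 1 (Some (myval p)) {}) else {})
      else {(leader v, NEWLEADER (NewLeaderMsg p v (locked_view s) (prepared_val s) (cert s)
                                    (pre_view s) (curr_val s)))})"
| "sends (Propose p M x) s = to_all (PROPOSE p (curr_view s) x M)"
| "sends (Vote p m) s =
     (case m of
        PROPOSE j v x M \<Rightarrow> to_all (PREPARED (PreparedMsg p v (hash x)))
      | _ \<Rightarrow> {})"
| "sends (Lock p C) s = to_all (COMMITTED p (curr_view s) (hash (curr_val s)))"
| "sends _ s = {}"

(* Some handler of p has to run. Locking and deciding do not falsify their own preconditions;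
   they have to run once per view (and may run again). *)

definition pending :: "real \<Rightarrow> proc \<Rightarrow> ('v, 'h) local_state \<Rightarrow> bool" where
  "pending c p s \<longleftrightarrow>
     (\<exists>M x. enabled c s (Propose p M x)) \<or>
     (\<exists>m. enabled c s (Vote p m)) \<or>
     (\<exists>C. enabled c s (Lock p C)) \<and> locked_view s \<noteq> curr_view s \<or>
     (enabled c s (FastDecide p) \<or> enabled c s (SlowDecide p)) \<and>
       (curr_view s, curr_val s) \<notin> decisions s"

end

(* Event k takes place at real time \<tau> k and takes the correct processes from the local states
   \<sigma> k to \<sigma> (Suc k). clk p t is the local clock of p at real time t. *)

locale sbft_execution = sbft f valid myval hash Ff
  for f :: nat
    and valid :: "'v \<Rightarrow> bool"
    and myval :: "proc \<Rightarrow> 'v"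
    and hash :: "'v option \<Rightarrow> 'h"
    and Ff :: "view \<Rightarrow> real" +
  fixes correct :: "proc set"
    and GST :: real
    and \<delta> :: real
    and clk :: "proc \<Rightarrow> real \<Rightarrow> real"
    and \<tau> :: "nat \<Rightarrow> real"
    and ev :: "nat \<Rightarrow> ('v, 'h) event"
    and \<sigma> :: "nat \<Rightarrow> proc \<Rightarrow> ('v, 'h) local_state"
  assumes correct_procs: "correct \<subseteq> procs"
    and faulty_bound: "card (procs - correct) \<le> f"
    and myval_valid: "p \<in> correct \<Longrightarrow> valid (myval p)"
    and delta_nonneg: "0 \<le> \<delta>"
    and clock_mono: "p \<in> correct \<Longrightarrow> mono (clk p)"
    and clock_after_GST:
      "p \<in> correct \<Longrightarrow> GST \<le> t \<Longrightarrow> GST \<le> t' \<Longrightarrow> clk p t' - clk p t = t' - t"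
    and time_mono: "mono \<tau>"
    and time_diverges: "\<exists>k. t < \<tau> k"
    and init: "p \<in> correct \<Longrightarrow> \<sigma> 0 p = init_state"
    and actor_correct: "actor (ev k) = Some p \<Longrightarrow> p \<in> correct"
    and step: "actor (ev k) = Some p \<Longrightarrow>
      enabled (clk p (\<tau> k)) (\<sigma> k p) (ev k) \<and>
      \<sigma> (Suc k) p = effect (clk p (\<tau> k)) (ev k) (\<sigma> k p)"
    and no_step: "p \<in> correct \<Longrightarrow> actor (ev k) \<noteq> Some p \<Longrightarrow> \<sigma> (Suc k) p = \<sigma> k p"
      \<comment> \<open>zero processing time: real time does not advance while a handler has to run\<close>
    and urgent: "p \<in> correct \<Longrightarrow> \<tau> k \<le> t \<Longrightarrow> t < \<tau> (Suc k) \<Longrightarrow>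
      \<not> pending (clk p t) p (\<sigma> (Suc k) p)"
    and authenticated_links: "ev k = Deliver q p m \<Longrightarrow>
      q \<in> procs \<and>
      (q \<in> correct \<longrightarrow> (\<exists>j<k. actor (ev j) = Some q \<and> (p, m) \<in> sends (ev j) (\<sigma> j q)))"
      \<comment> \<open>a faulty process may send anything built from signatures that were already issued
          and signatures of faulty processes\<close>
    and unforgeable: "ev k = Deliver q p m \<Longrightarrow> m' \<in> signed_parts m \<Longrightarrow> signer m' \<in> correct \<Longrightarrow>
      \<exists>j<k. actor (ev j) = Some (signer m') \<and>
        (\<exists>r. (r, m') \<in> sends (ev j) (\<sigma> j (signer m')))"
    and timely: "actor (ev k) = Some q \<Longrightarrow> (p, m) \<in> sends (ev k) (\<sigma> k q) \<Longrightarrow>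
      p \<in> correct \<Longrightarrow> GST \<le> \<tau> k \<Longrightarrow>
      \<exists>j>k. ev j = Deliver q p m \<and> \<tau> j \<le> \<tau> k + \<delta>"
    and self_delivery: "actor (ev k) = Some p \<Longrightarrow> (p, m) \<in> sends (ev k) (\<sigma> k p) \<Longrightarrow>
      \<exists>j>k. ev j = Deliver p p m"
    and started: "p \<in> correct \<Longrightarrow> \<exists>k. ev k = Start p"

definition enters :: "(nat \<Rightarrow> ('v, 'h) event) \<Rightarrow> proc \<Rightarrow> view \<Rightarrow> bool" where
  "enters ev p v \<longleftrightarrow> (\<exists>k. ev k = NewView p v)"

definition entry_time :: "(nat \<Rightarrow> real) \<Rightarrow> (nat \<Rightarrow> ('v, 'h) event) \<Rightarrow> proc \<Rightarrow> view \<Rightarrow> real" where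
  "entry_time \<tau> ev p v = \<tau> (THE k. ev k = NewView p v)"

(* Meaningful only if some correct process enters the view. *)

definition E_first ::
  "proc set \<Rightarrow> (nat \<Rightarrow> real) \<Rightarrow> (nat \<Rightarrow> ('v, 'h) event) \<Rightarrow> view \<Rightarrow> real" where
  "E_first correct \<tau> ev v = Min {entry_time \<tau> ev p v | p. p \<in> correct \<and> enters ev p v}"

definition E_last ::
  "proc set \<Rightarrow> (nat \<Rightarrow> real) \<Rightarrow> (nat \<Rightarrow> ('v, 'h) event) \<Rightarrow> view \<Rightarrow> real" where
  "E_last correct \<tau> ev v = Max {entry_time \<tau> ev p v | p. p \<in> correct \<and> enters ev p v}"

locale synchronizer =
  fixes correct :: "proc set"
    and GST :: real
    and \<tau> :: "nat \<Rightarrow> real"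
    and ev :: "nat \<Rightarrow> ('v, 'h) event"
    and F :: "nat \<Rightarrow> real"
    and \<V> :: view
    and d :: real
  assumes F_mono: "mono F"
    and F_zero: "F 0 = 0"
    and V_pos: "1 \<le> \<V>"
    and enters_once: "p \<in> correct \<Longrightarrow> ev j = NewView p v \<Longrightarrow> ev k = NewView p v \<Longrightarrow> j = k"
    and P1: "p \<in> correct \<Longrightarrow> v < v' \<Longrightarrow> enters ev p v \<Longrightarrow> enters ev p v' \<Longrightarrow>
      entry_time \<tau> ev p v < entry_time \<tau> ev p v'"
    and P2: "GST \<le> E_first correct \<tau> ev \<V>"
    and P3: "p \<in> correct \<Longrightarrow> \<V> \<le> v \<Longrightarrow> enters ev p v"
    and P4: "\<V> \<le> v \<Longrightarrow> E_last correct \<tau> ev v \<le> E_first correct \<tau> ev v + d"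
    and P5: "\<V> \<le> v \<Longrightarrow> E_first correct \<tau> ev v + F v \<le> E_first correct \<tau> ev (v + 1)"

end

theory Submission
  imports Defs
begin

text \<open>The slow path alone suffices. Choose a view \<open>v\<close> after \<open>GST\<close> with a correct leader whose duration
  exceeds the fast-path timeout by more than \<open>6 * \<delta>\<close>, and let \<open>E\<close> be the time of the first correct
  entry. All correct \<open>NEWLEADER\<close> messages reach the leader by \<open>E + 3 * \<delta>\<close>, all correct processes vote
  for its proposal by \<open>E + 4 * \<delta>\<close>, lock by \<open>E + 5 * \<delta> + Ff v\<close> and decide by \<open>E + 6 * \<delta> + Ff v\<close>, before
  anyone leaves \<open>v\<close>. The proposal is acceptable because a value that the leader has to repropose is
  backed by a certificate or by \<open>f + 1\<close> reports, hence by a correct process that voted for it.\<close>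

locale sbft_run =
  sbft_execution f valid myval hash Ff correct GST \<delta> clk \<tau> ev \<sigma> +
  synchronizer correct GST \<tau> ev F \<V> "2 * \<delta>"
  for f :: nat
    and valid :: "'v \<Rightarrow> bool"
    and myval :: "proc \<Rightarrow> 'v"
    and hash :: "'v option \<Rightarrow> 'h"
    and Ff :: "view \<Rightarrow> real"
    and correct :: "proc set"
    and GST :: real
    and \<delta> :: real
    and clk :: "proc \<Rightarrow> real \<Rightarrow> real"
    and \<tau> :: "nat \<Rightarrow> real"
    and ev :: "nat \<Rightarrow> ('v, 'h) event"
    and \<sigma> :: "nat \<Rightarrow> proc \<Rightarrow> ('v, 'h) local_state"
    and F :: "nat \<Rightarrow> real"
    and \<V> :: view
begin

subsection \<open>Processes and leaders\<close>

lemma finite_correct: "finite correct"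
  using correct_procs by (auto simp: procs_def intro: finite_subset)

lemma card_correct: "2 * f + 1 \<le> card correct"
proof -
  have "card (procs - correct) = card procs - card correct"
    using finite_correct correct_procs by (rule card_Diff_subset)
  then show ?thesis
    using faulty_bound by (simp add: procs_def)
qed

text \<open>At most \<open>f\<close> processes are faulty, so \<open>f + 1\<close> of them cannot
  all be. Certificates and groups of \<open>f + 1\<close> reports are both exploited through this
  fact.\<close>

lemma correct_member:
  assumes "Q \<subseteq> procs" and "f + 1 \<le> card Q"
  obtains q where "q \<in> Q" and "q \<in> correct"
proof -
  have "\<not> Q \<subseteq> procs - correct"
  proof
    assume "Q \<subseteq> procs - correct"
    then have "card Q \<le> card (procs - correct)"
      by (rule card_mono[rotated]) (simp add: procs_def)
    then show False
      using assms(2) faulty_bound by simp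
  qed
  then show ?thesis
    using assms(1) that by blast
qed

text \<open>Leaders rotate with period \<open>3 * f + 1\<close>, so a correct \<open>p\<close> leads
  the view \<open>(3 * f + 1) * w + p\<close>.\<close>

lemma ex_correct_leader: "\<exists>v\<ge>w. leader v \<in> correct"
proof -
  obtain p where p: "p \<in> correct"
    using card_correct by fastforce
  then obtain q where q: "p = Suc q" "q < 3 * f + 1"
    using correct_procs by (cases p) (auto simp: procs_def)
  then have "leader ((3 * f + 1) * w + p) = (q + (3 * f + 1) * w) mod (3 * f + 1) + 1"
    by (simp add: leader_def add.commute)
  also have "\<dots> = p"
    unfolding mod_mult_self2 using q by simp
  finally have "leader ((3 * f + 1) * w + p) = p" .
  moreover have "w \<le> (3 * f + 1) * w + p"
    by (simp add: trans_le_add1)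
  ultimately show ?thesis
    using p by metis
qed

subsection \<open>Local invariants\<close>

lemma local_step_cases [consumes 1, case_names stutter act]:
  assumes "p \<in> correct"
  obtains "actor (ev k) \<noteq> Some p" and "\<sigma> (Suc k) p = \<sigma> k p"
  | "actor (ev k) = Some p" and "enabled (clk p (\<tau> k)) (\<sigma> k p) (ev k)"
    and "\<sigma> (Suc k) p = effect (clk p (\<tau> k)) (ev k) (\<sigma> k p)"
  using assms no_step step by blast

lemma safe_proposalE:
  assumes "safe_proposal m"
  obtains v y M where "m = PROPOSE (leader v) v (Some y) M" and "valid y"
  using assms by (cases m) auto

text \<open>\<open>NewView\<close> is the only event that changes \<open>curr_view\<close>, which
  starts at 0.\<close>

lemma entered:
  assumes p: "p \<in> correct"
  shows "curr_view (\<sigma> k p) \<noteq> 0 \<Longrightarrow> \<exists>j<k. ev j = NewView p (curr_view (\<sigma> k p))"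
proof (induction k)
  case 0
  then show ?case
    by (simp add: init[OF p] init_state_def)
next
  case (Suc k)
  from p show ?case
  proof (cases rule: local_step_cases[where k = k])
    case stutter
    then show ?thesis
      using Suc less_SucI by metis
  next
    case act
    then show ?thesis
      using Suc by (cases "ev k") (auto simp: less_Suc_eq split: msg.splits)
  qed
qed

lemma entry_time_eq: "p \<in> correct \<Longrightarrow> ev k = NewView p v \<Longrightarrow> entry_time \<tau> ev p v = \<tau> k"
  using enters_once by (auto simp: entry_time_def intro!: arg_cong[where f = \<tau>] the_equality)

text \<open>A \<open>NewView\<close> event may carry any positive view; monotonicity comes from the
  synchronizer. The current view was itself entered by an earlier event, so \<open>v\<close> equal
  to it contradicts \<open>enters_once\<close>, and \<open>v\<close> below it contradicts
  (P1).\<close>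

lemma NewView_increases:
  assumes p: "p \<in> correct" and k: "ev k = NewView p v"
  shows "curr_view (\<sigma> k p) < v"
proof (rule ccontr)
  let ?u = "curr_view (\<sigma> k p)"
  assume "\<not> ?u < v"
  moreover have "1 \<le> v"
    using step[of k p] k by simp
  ultimately obtain j where j: "j < k" "ev j = NewView p ?u" and le: "v \<le> ?u"
    using entered[OF p, of k] by auto
  have "v \<noteq> ?u"
    using enters_once[OF p, of j ?u k] j k by auto
  then have "entry_time \<tau> ev p v < entry_time \<tau> ev p ?u"
    using P1[OF p, of v ?u] j k le by (auto simp: enters_def)
  then have "\<tau> k < \<tau> j"
    using entry_time_eq[OF p] j k by simp
  then show False
    using monoD[OF time_mono, of j k] j(1) by simp
qed

lemma curr_view_Suc:
  assumes p: "p \<in> correct"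
  shows "curr_view (\<sigma> k p) \<le> curr_view (\<sigma> (Suc k) p)"
  using p
proof (cases rule: local_step_cases[where k = k])
  case act
  then show ?thesis
    using NewView_increases[OF p, of k]
    by (cases "ev k") (auto split: msg.splits intro: less_imp_le)
qed simp

lemma curr_view_mono: "p \<in> correct \<Longrightarrow> j \<le> k \<Longrightarrow> curr_view (\<sigma> j p) \<le> curr_view (\<sigma> k p)"
  by (rule lift_Suc_mono_le[of "\<lambda>k. curr_view (\<sigma> k p)"]) (simp_all add: curr_view_Suc)

text \<open>An inductive invariant. It makes \<open>NEWLEADER\<close> messages of correct processes
  pass \<open>valid_new_leader\<close>, makes the values they report valid, and leaves only two
  values of \<open>voted\<close> inside a view. The clause tying a vote to \<open>pre_view\<close>
  lets \<open>Lock\<close> preserve \<open>locked_view s \<le> pre_view s\<close>.\<close>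

definition wf_state :: "('v, 'h) local_state \<Rightarrow> bool" where
  "wf_state s \<longleftrightarrow>
     locked_view s \<le> pre_view s \<and> pre_view s \<le> curr_view s \<and>
     (voted s = Some True \<longrightarrow> pre_view s = curr_view s) \<and>
     (voted s = None \<longleftrightarrow> curr_view s = 0) \<and>
     (locked_view s \<noteq> 0 \<longrightarrow> prepared (cert s) (locked_view s) (hash (prepared_val s))) \<and>
     (pre_view s \<noteq> 0 \<longrightarrow> (\<exists>y. curr_val s = Some y \<and> valid y))"

lemma wf_states: "p \<in> correct \<Longrightarrow> wf_state (\<sigma> k p)"
proof (induction k)
  case 0
  then show ?case
    by (simp add: init init_state_def wf_state_def)
next
  case (Suc k)
  from Suc.prems show ?case
  proof (cases rule: local_step_cases[where k = k])
    case stutter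
    then show ?thesis
      using Suc by simp
  next
    case act
    have wf: "wf_state (\<sigma> k p)"
      using Suc by simp
    show ?thesis
    proof (cases "ev k")
      case (NewView q v)
      then show ?thesis
        using act wf NewView_increases[OF Suc.prems, of k v] by (auto simp: wf_state_def)
    next
      case (Vote q m)
      then show ?thesis
        using act wf by (auto simp: wf_state_def elim!: safe_proposalE)
    next
      case (Lock q C)
      then show ?thesis
        using act wf by (auto simp: wf_state_def prepared_def)
    qed (use act wf in \<open>auto simp: wf_state_def\<close>)
  qed
qed

section \<open>Tracing local states back to events\<close>

lemma received_delivered:
  assumes p: "p \<in> correct"
  shows "m \<in> received (\<sigma> k p) \<Longrightarrow> \<exists>j<k. \<exists>q. ev j = Deliver q p m"
proof (induction k)
  case 0
  then show ?case
    by (simp add: init[OF p] init_state_def)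
next
  case (Suc k)
  from p show ?case
  proof (cases rule: local_step_cases[where k = k])
    case stutter
    then show ?thesis
      using Suc less_SucI by metis
  next
    case act
    then show ?thesis
      using Suc
      by (cases "ev k") (auto simp: less_Suc_eq store_def Let_def split: msg.splits if_splits)
  qed
qed

text \<open>Whatever is received was delivered earlier, and unforgeability covers every signed part
  of it. Hence votes nested in a certificate can be traced as well.\<close>

lemma received_sent:
  assumes "p \<in> correct" and "m \<in> received (\<sigma> k p)"
    and "m' \<in> signed_parts m" and "signer m' \<in> correct"
  shows "\<exists>j<k. actor (ev j) = Some (signer m') \<and>
    (\<exists>r. (r, m') \<in> sends (ev j) (\<sigma> j (signer m')))"
  using received_delivered[OF assms(1,2)] unforgeable[OF _ assms(3,4)] less_trans by metis

lemma signed_parts_self: "m \<in> signed_parts m"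
  by (cases m) (auto simp: newleader_parts_def)

text \<open>Every view entry clears the flag, so it witnesses an event of the current view, which
  can then be dated.\<close>

lemma proposed_event:
  assumes p: "p \<in> correct"
  shows "proposed (\<sigma> k p) \<Longrightarrow>
    \<exists>j<k. \<exists>M x. ev j = Propose p M x \<and> curr_view (\<sigma> j p) = curr_view (\<sigma> k p)"
proof (induction k)
  case 0
  then show ?case
    by (simp add: init[OF p] init_state_def)
next
  case (Suc k)
  from p show ?case
  proof (cases rule: local_step_cases[where k = k])
    case stutter
    then show ?thesis
      using Suc less_SucI by metis
  next
    case act
    then show ?thesis
      using Suc by (cases "ev k") (auto simp: less_Suc_eq split: msg.splits)
  qed
qed

lemma voted_event:
  assumes p: "p \<in> correct"
  shows "voted (\<sigma> k p) = Some True \<Longrightarrow>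
    \<exists>j<k. \<exists>i M. ev j = Vote p (PROPOSE i (curr_view (\<sigma> k p)) (curr_val (\<sigma> k p)) M) \<and>
      timer (\<sigma> k p) = Some (clk p (\<tau> j) + Ff (curr_view (\<sigma> k p)))"
proof (induction k)
  case 0
  then show ?case
    by (simp add: init[OF p] init_state_def)
next
  case (Suc k)
  from p show ?case
  proof (cases rule: local_step_cases[where k = k])
    case stutter
    then show ?thesis
      using Suc less_SucI by metis
  next
    case act
    then show ?thesis
      using Suc by (cases "ev k") (auto simp: less_Suc_eq elim!: safe_proposalE)
  qed
qed

text \<open>\<open>NewView\<close> does not reset \<open>locked_view\<close>, but by
  \<open>wf_state\<close> it raises \<open>curr_view\<close> strictly above it, so equality must
  come from a \<open>Lock\<close> in the current view.\<close>

lemma locked_event: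
  assumes p: "p \<in> correct"
  shows "locked_view (\<sigma> k p) = curr_view (\<sigma> k p) \<Longrightarrow> curr_view (\<sigma> k p) \<noteq> 0 \<Longrightarrow>
    \<exists>j<k. \<exists>C. ev j = Lock p C \<and> curr_view (\<sigma> j p) = curr_view (\<sigma> k p)"
proof (induction k)
  case 0
  then show ?case
    by (simp add: init[OF p] init_state_def)
next
  case (Suc k)
  from p show ?case
  proof (cases rule: local_step_cases[where k = k])
    case stutter
    then show ?thesis
      using Suc less_SucI by metis
  next
    case act
    show ?thesis
    proof (cases "ev k")
      case (NewView q v)
      then show ?thesis
        using act Suc.prems NewView_increases[OF p, of k v] wf_states[OF p, of k]
        by (auto simp: wf_state_def)
    qed (use act Suc in \<open>auto simp: less_Suc_eq split: msg.splits\<close>)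
  qed
qed

text \<open>Entries strictly increase the view, so none occurs between \<open>j\<close> and
  \<open>k\<close>; and a second vote in the same view is blocked by \<open>voted\<close>.\<close>

lemma same_view_stable:
  assumes p: "p \<in> correct" and "j \<le> k"
  shows "curr_view (\<sigma> j p) = curr_view (\<sigma> k p) \<Longrightarrow>
    (proposed (\<sigma> j p) \<longrightarrow> proposed (\<sigma> k p)) \<and>
    (locked_view (\<sigma> j p) = curr_view (\<sigma> k p) \<longrightarrow> locked_view (\<sigma> k p) = curr_view (\<sigma> k p)) \<and>
    (voted (\<sigma> j p) = Some True \<longrightarrow>
       voted (\<sigma> k p) = Some True \<and> curr_val (\<sigma> k p) = curr_val (\<sigma> j p))"
  using \<open>j \<le> k\<close>
proof (induction k rule: dec_induct)
  case base
  then show ?case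
    by simp
next
  case (step k)
  have view: "curr_view (\<sigma> j p) = curr_view (\<sigma> k p)"
    using curr_view_mono[OF p step.hyps(1)] curr_view_Suc[OF p, of k] step.prems by simp
  from p show ?case
  proof (cases rule: local_step_cases[where k = k])
    case stutter
    then show ?thesis
      using step.IH view by simp
  next
    case act
    then show ?thesis
      using step.IH[OF view] view step.prems NewView_increases[OF p, of k]
      by (cases "ev k") (auto split: msg.splits)
  qed
qed

section \<open>Messages of correct processes: no equivocation within a view\<close>

lemma sent_view:
  assumes "actor (ev k) = Some q" and "(r, m) \<in> sends (ev k) (\<sigma> k q)"
  shows "msg_view m = curr_view (\<sigma> (Suc k) q)" and "signer m = q"
  using step[OF assms(1)] assms
  by (cases "ev k"; auto simp: to_all_def split: msg.splits if_splits)+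

text \<open>Records for each kind what excludes a second, different message: an event that occurs
  once, a flag that flips, or a value frozen by the vote. View 1 is excluded because there
  \<open>NewView\<close> sends the proposal.\<close>

lemma sent_content:
  assumes "actor (ev k) = Some q" and "(r, m) \<in> sends (ev k) (\<sigma> k q)"
    and "kind m = K" and "msg_view m = v" and "v \<noteq> 1"
  shows "case K of
      K_newleader \<Rightarrow> ev k = NewView q v
    | K_propose \<Rightarrow> (\<exists>M x. ev k = Propose q M x) \<and> \<not> proposed (\<sigma> k q) \<and> proposed (\<sigma> (Suc k) q)
    | K_prepared \<Rightarrow> voted (\<sigma> (Suc k) q) = Some True \<and>
        m = PREPARED (PreparedMsg q v (hash (curr_val (\<sigma> (Suc k) q))))
    | K_committed \<Rightarrow> voted (\<sigma> (Suc k) q) = Some True \<and>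
        m = COMMITTED q v (hash (curr_val (\<sigma> (Suc k) q)))"
  using step[OF assms(1)] assms
  by (cases "ev k") (auto simp: to_all_def split: msg.splits if_splits)

lemma sent_unique_aux:
  assumes j: "actor (ev j) = Some q" "(r, m) \<in> sends (ev j) (\<sigma> j q)"
    and k: "actor (ev k) = Some q" "(r', m') \<in> sends (ev k) (\<sigma> k q)"
    and eq: "kind m = kind m'" "msg_view m = msg_view m'"
    and "msg_view m \<noteq> 1" and "j < k"
  shows "m = m'"
proof -
  have q: "q \<in> correct"
    using actor_correct j(1) .
  have views: "curr_view (\<sigma> (Suc j) q) = curr_view (\<sigma> (Suc k) q)"
    using sent_view(1)[OF j] sent_view(1)[OF k] eq by simp
  have "curr_view (\<sigma> (Suc j) q) \<le> curr_view (\<sigma> k q)"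
    using curr_view_mono[OF q, of "Suc j" k] \<open>j < k\<close> by simp
  then have views': "curr_view (\<sigma> (Suc j) q) = curr_view (\<sigma> k q)"
    using curr_view_Suc[OF q, of k] views by simp
  \<comment> \<open>Two instances: the state before event \<open>k\<close> shows that
    \<open>proposed\<close> was already set, the state after it that \<open>curr_val\<close> is
    unchanged.\<close>
  note stable = same_view_stable[OF q _ views'] same_view_stable[OF q _ views]
  show ?thesis
    using sent_content[OF j eq] sent_content[OF k refl refl]
      enters_once[OF q, of j "msg_view m'" k] stable \<open>j < k\<close> \<open>msg_view m \<noteq> 1\<close> eq(2)
    by (cases "kind m'") auto
qed

lemma sent_unique:
  assumes "actor (ev j) = Some q" "(r, m) \<in> sends (ev j) (\<sigma> j q)"
    and "actor (ev k) = Some q" "(r', m') \<in> sends (ev k) (\<sigma> k q)"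
    and "kind m = kind m'" "msg_view m = msg_view m'" "msg_view m \<noteq> 1"
  shows "m = m'"
proof (cases j k rule: linorder_cases)
  case less
  then show ?thesis
    using sent_unique_aux assms by blast
next
  case equal
  then show ?thesis
    using assms by (cases "ev j") (auto simp: to_all_def split: msg.splits if_splits)
next
  case greater
  then show ?thesis
    using sent_unique_aux[OF assms(3,4,1,2)] assms(5-7) by simp
qed

subsection \<open>Validity of proposals\<close>

text \<open>The leader is never stuck: the fast choice is total, and the maximal locked view of a
  finite nonempty \<open>M\<close> is attained.\<close>

lemma ex_leader_choice:
  assumes "finite M" and "M \<noteq> {}"
  shows "\<exists>x. leader_choice p M x"
proof -
  have "Max (nl_locked_view ` M) \<in> nl_locked_view ` M"
    using assms by simp
  then obtain l where l: "l \<in> M" "nl_locked_view l = Max (nl_locked_view ` M)"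
    by auto
  have "\<exists>x_slow v_slow. slow_choice M x_slow v_slow"
  proof (cases "nl_locked_view l = 0")
    case True
    then show ?thesis
      using l by (auto simp: slow_choice_def Let_def)
  next
    case False
    then have "slow_choice M (nl_prepared_val l) (nl_locked_view l)"
      using l by (auto simp: slow_choice_def Let_def)
    then show ?thesis
      by blast
  qed
  moreover obtain x_fast v_fast where "fast_choice M = (x_fast, v_fast)"
    by fastforce
  ultimately have "\<exists>x_slow v_slow. selection M x_slow v_slow x_fast v_fast"
    by (simp add: selection_def)
  then show ?thesis
    unfolding leader_choice_def by blast
qed

text \<open>A prepared certificate contains the vote of a correct process for a safe proposal.\<close>

lemma prepared_valid:
  assumes p: "p \<in> correct" and l: "NEWLEADER l \<in> received (\<sigma> k p)"
    and prep: "prepared (nl_cert l) u (hash x)"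
  shows "\<exists>y. x = Some y \<and> valid y"
proof -
  obtain Q where Q: "Q \<subseteq> procs" "2 * f + 1 \<le> card Q"
    and cert: "nl_cert l = Some {PreparedMsg j u (hash x) | j. j \<in> Q}"
    using prep by (auto simp: prepared_def certifies_def)
  obtain q where q: "q \<in> Q" "q \<in> correct"
    using correct_member[OF Q(1)] Q(2) by auto
  have "PREPARED (PreparedMsg q u (hash x)) \<in> signed_parts (NEWLEADER l)"
    using cert q(1) by (auto simp: newleader_parts_def)
  then obtain j r where j: "actor (ev j) = Some q"
    "(r, PREPARED (PreparedMsg q u (hash x))) \<in> sends (ev j) (\<sigma> j q)"
    using received_sent[OF p l] q(2) by fastforce
  \<comment> \<open>Only \<open>Vote\<close> sends \<open>PREPARED\<close>, and injectivity of
    \<open>hash\<close> identifies the value voted for with \<open>x\<close>.\<close>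
  then show ?thesis
    using step[OF j(1)]
    by (cases "ev j")
      (auto simp: to_all_def inj_eq[OF hash_perfect] split: if_splits elim!: safe_proposalE)
qed

text \<open>Some member of \<open>P\<close> has a correct signer. Its \<open>pre_view\<close> is at
  least the minimum \<open>u\<close>, hence nonzero, and \<open>wf_state\<close> then makes the
  reported value valid.\<close>

lemma candidate_valid:
  assumes p: "p \<in> correct" and M: "NEWLEADER ` M \<subseteq> received (\<sigma> k p)" "newleader_quorum w M"
    and xu: "(x, u) \<in> fast_candidates M" and u: "u \<noteq> 0"
  shows "\<exists>y. x = Some y \<and> valid y"
proof -
  obtain P where P: "P \<subseteq> M" "card P = f + 1" "\<forall>l\<in>P. nl_curr_val l = x" "u = Min (nl_pre_view ` P)"
    using xu by (auto simp: fast_candidates_def)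
  obtain Q where Q: "quorum Q" "bij_betw nl_signer M Q"
    using M(2) by (auto simp: newleader_quorum_def)
  \<comment> \<open>Distinct messages have distinct signers, so \<open>f + 1\<close> messages stand
    for \<open>f + 1\<close> processes.\<close>
  have "inj_on nl_signer P"
    using Q(2) P(1) by (meson bij_betw_def inj_on_subset)
  then have card: "card (nl_signer ` P) = f + 1"
    using P(2) by (simp add: card_image)
  have "nl_signer ` P \<subseteq> procs"
    using P(1) Q by (auto simp: bij_betw_def quorum_def)
  then obtain q where "q \<in> nl_signer ` P" "q \<in> correct"
    by (rule correct_member) (use card in simp_all)
  then obtain l where l: "l \<in> P" "nl_signer l \<in> correct"
    by blast
  have "finite P"
    using P(2) card.infinite by fastforce
  then have "u \<le> nl_pre_view l"
    using P(4) l(1) by simp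
  then have pre: "nl_pre_view l \<noteq> 0"
    using u by simp
  have "NEWLEADER l \<in> received (\<sigma> k p)"
    using M(1) P(1) l(1) by auto
  then obtain j r where j: "actor (ev j) = Some (nl_signer l)"
    "(r, NEWLEADER l) \<in> sends (ev j) (\<sigma> j (nl_signer l))"
    using received_sent[OF p _ signed_parts_self, of "NEWLEADER l" k] l(2)
    unfolding signer.simps by blast
  then have "nl_pre_view l = pre_view (\<sigma> j (nl_signer l))"
    "nl_curr_val l = curr_val (\<sigma> j (nl_signer l))"
    by (cases l; cases "ev j"; auto simp: to_all_def split: msg.splits if_splits)+
  then show ?thesis
    using wf_states[OF l(2), of j] pre P(3) l(1) by (simp add: wf_state_def)
qed

lemma leader_choice_valid:
  assumes p: "p \<in> correct" and M: "NEWLEADER ` M \<subseteq> received (\<sigma> k p)" "newleader_quorum w M"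
    and choice: "leader_choice p M x"
  shows "\<exists>y. x = Some y \<and> valid y"
proof -
  obtain x_slow v_slow x_fast v_fast where sel: "selection M x_slow v_slow x_fast v_fast"
    and x: "x = (if v_slow \<ge> v_fast \<and> v_slow > 0 then x_slow
             else if v_fast > v_slow then x_fast else Some (myval p))"
    using choice by (auto simp: leader_choice_def)
  consider "v_slow \<ge> v_fast" "v_slow > 0" "x = x_slow"
    | "v_fast > 0" "x = x_fast" | "x = Some (myval p)"
    using x by (auto split: if_splits)
  then show ?thesis
  proof cases
    case 1
    then obtain l where l: "l \<in> M" "nl_locked_view l = v_slow" "x = nl_prepared_val l"
      using sel by (auto simp: selection_def slow_choice_def Let_def split: if_splits)
    then have "prepared (nl_cert l) v_slow (hash x)"
      using M(2) 1 by (auto simp: newleader_quorum_def valid_new_leader_def)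
    then show ?thesis
      using prepared_valid[OF p] M(1) l(1) by blast
  next
    case 2
    let ?D = "fast_candidates M"
    have fast: "(x, v_fast) = fast_choice M"
      using sel 2 by (simp add: selection_def)
    \<comment> \<open>A positive \<open>v_fast\<close> rules out the default
      \<open>(None, 0)\<close>, so the \<open>THE\<close> in \<open>fast_choice\<close> denotes a
      genuine candidate.\<close>
    then have ex1: "\<exists>!x. (x, Max (snd ` ?D)) \<in> ?D"
      and eq: "x = (THE x. (x, Max (snd ` ?D)) \<in> ?D)" "v_fast = Max (snd ` ?D)"
      using 2(1) by (auto simp: fast_choice_def Let_def split: if_splits)
    have "(x, v_fast) \<in> ?D"
      using theI'[OF ex1] eq by simp
    then show ?thesis
      using candidate_valid[OF p M] 2(1) by simp
  next
    case 3
    then show ?thesis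
      using myval_valid[OF p] by simp
  qed
qed

subsection \<open>Quiescent states\<close>

text \<open>In state \<open>\<sigma> (horizon T)\<close> all events up to real time \<open>T\<close> have taken place, hence by zero processing
  time no handler is pending.\<close>

definition horizon :: "real \<Rightarrow> nat" where
  "horizon T = (LEAST k. T < \<tau> k)"

text \<open>Translates between event indices and real time: divergence of time makes the
  \<open>LEAST\<close> exist, and monotonicity makes the events up to \<open>T\<close> an initial
  segment.\<close>

lemma less_horizon_iff: "k < horizon T \<longleftrightarrow> \<tau> k \<le> T"
proof
  assume "k < horizon T"
  then show "\<tau> k \<le> T"
    unfolding horizon_def using not_less_Least not_less by blast
next
  assume "\<tau> k \<le> T"
  moreover have "T < \<tau> (horizon T)"
    unfolding horizon_def using time_diverges by (rule LeastI_ex)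
  ultimately have "\<not> \<tau> (horizon T) \<le> \<tau> k"
    by simp
  then show "k < horizon T"
    using monoD[OF time_mono, of "horizon T" k] by force
qed

text \<open>Urgency speaks of states after an event; the event \<open>k\<close> up to time
  \<open>T\<close> ensures that the horizon is a successor.\<close>

lemma not_pending_horizon:
  assumes "p \<in> correct" and "\<tau> k \<le> T"
  shows "\<not> pending (clk p T) p (\<sigma> (horizon T) p)"
proof -
  obtain i where i: "horizon T = Suc i"
    using assms(2) less_horizon_iff[of k T] by (cases "horizon T") auto
  then have "\<tau> i \<le> T" "T < \<tau> (Suc i)"
    using less_horizon_iff[of i T] less_horizon_iff[of "Suc i" T] by auto
  then show ?thesis
    using urgent[OF assms(1)] i by simp
qed

subsection \<open>View synchronization\<close>

lemma E_first_eq: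
    "E_first correct \<tau> ev v =
      Min ((\<lambda>p. entry_time \<tau> ev p v) ` {p \<in> correct. enters ev p v})"
  and E_last_eq:
    "E_last correct \<tau> ev v =
      Max ((\<lambda>p. entry_time \<tau> ev p v) ` {p \<in> correct. enters ev p v})"
  by (auto simp: E_first_def E_last_def intro: arg_cong[where f = Min] arg_cong[where f = Max])

lemma E_first_le: "ev k = NewView p v \<Longrightarrow> E_first correct \<tau> ev v \<le> \<tau> k"
  and le_E_last: "ev k = NewView p v \<Longrightarrow> \<tau> k \<le> E_last correct \<tau> ev v"
proof -
  assume k: "ev k = NewView p v"
  then have "p \<in> correct"
    using actor_correct[of k p] by simp
  then have "\<tau> k \<in> (\<lambda>p. entry_time \<tau> ev p v) ` {p \<in> correct. enters ev p v}"
    using k entry_time_eq by (force simp: enters_def)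
  then show "E_first correct \<tau> ev v \<le> \<tau> k" "\<tau> k \<le> E_last correct \<tau> ev v"
    unfolding E_first_eq E_last_eq using finite_correct by simp_all
qed

text \<open>\<open>F\<close> is nonnegative, being monotone with \<open>F 0 = 0\<close>, so (P5) can
  be chained.\<close>

lemma E_first_mono:
  assumes "\<V> \<le> v" and "v \<le> w"
  shows "E_first correct \<tau> ev v \<le> E_first correct \<tau> ev w"
  using assms(2)
proof (induction w rule: dec_induct)
  case (step w)
  then show ?case
    using P5[of w] monoD[OF F_mono, of 0 w] F_zero assms(1) by simp
qed simp

lemma E_first_later_view:
  assumes "\<V> \<le> v" and "v < w"
  shows "E_first correct \<tau> ev v + F v \<le> E_first correct \<tau> ev w"
  using P5[of v] E_first_mono[of "v + 1" w] assms by simp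

end

section \<open>One long view with a correct leader\<close>

locale good_view = sbft_run f valid myval hash Ff correct GST \<delta> clk \<tau> ev \<sigma> F \<V>
  for f :: nat
    and valid :: "'v \<Rightarrow> bool"
    and myval :: "proc \<Rightarrow> 'v"
    and hash :: "'v option \<Rightarrow> 'h"
    and Ff :: "view \<Rightarrow> real"
    and correct :: "proc set"
    and GST :: real
    and \<delta> :: real
    and clk :: "proc \<Rightarrow> real \<Rightarrow> real"
    and \<tau> :: "nat \<Rightarrow> real"
    and ev :: "nat \<Rightarrow> ('v, 'h) event"
    and \<sigma> :: "nat \<Rightarrow> proc \<Rightarrow> ('v, 'h) local_state"
    and F :: "nat \<Rightarrow> real"
    and \<V> :: view +
  fixes v :: view
  assumes v_ge: "\<V> \<le> v"
    and v_gt_1: "1 < v"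
    and leader_correct: "leader v \<in> correct"
    and long_enough: "Ff v + 6 * \<delta> < F v"
begin

abbreviation E :: real where
  "E \<equiv> E_first correct \<tau> ev v"

lemma GST_le_E: "GST \<le> E"
  using P2 E_first_mono[OF order_refl v_ge] by simp

lemma entry:
  assumes "p \<in> correct"
  obtains k where "ev k = NewView p v" and "\<tau> k \<le> E + 2 * \<delta>"
proof -
  obtain k where k: "ev k = NewView p v"
    using P3[OF assms v_ge] by (auto simp: enters_def)
  then show ?thesis
    using that[OF k] le_E_last[OF k] P4[OF v_ge] by simp
qed

lemma in_view_time:
  assumes "p \<in> correct" and "curr_view (\<sigma> k p) = v"
  obtains j where "j < k" and "ev j = NewView p v" and "E \<le> \<tau> j"
  using entered[OF assms(1), of k] assms(2) v_gt_1 E_first_le by auto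

text \<open>Any view above \<open>v\<close> is first entered at \<open>E + F v\<close> or later,
  which is after \<open>T\<close>.\<close>

lemma curr_view_le:
  assumes p: "p \<in> correct" and "T < E + F v" and "k \<le> horizon T"
  shows "curr_view (\<sigma> k p) \<le> v"
proof (rule ccontr)
  assume "\<not> ?thesis"
  then obtain j where j: "j < k" "ev j = NewView p (curr_view (\<sigma> k p))" and "v < curr_view (\<sigma> k p)"
    using entered[OF p, of k] by auto
  then have "E + F v \<le> \<tau> j"
    using E_first_later_view[OF v_ge] E_first_le[OF j(2)] by fastforce
  then show False
    using j(1) assms less_horizon_iff[of j T] by simp
qed

lemma curr_view_eq:
  assumes p: "p \<in> correct" and T: "E + 2 * \<delta> \<le> T" "T < E + F v"
  shows "curr_view (\<sigma> (horizon T) p) = v"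
proof -
  obtain k where k: "ev k = NewView p v" "\<tau> k \<le> E + 2 * \<delta>"
    using entry[OF p] by blast
  then have "curr_view (\<sigma> (Suc k) p) = v"
    using step[of k p] by simp
  moreover have "Suc k \<le> horizon T"
    using k T less_horizon_iff[of k T] by simp
  ultimately show ?thesis
    using curr_view_mono[OF p, of "Suc k" "horizon T"] curr_view_le[OF p T(2)] by fastforce
qed

lemma not_pending:
  assumes "p \<in> correct" and "E + 2 * \<delta> \<le> T"
  shows "\<not> pending (clk p T) p (\<sigma> (horizon T) p)"
proof -
  obtain k where "\<tau> k \<le> E + 2 * \<delta>"
    using entry[OF assms(1)] by blast
  then show ?thesis
    using not_pending_horizon[OF assms(1), of k T] assms(2) by simp
qed

text \<open>Buffering keeps only the message with the highest view of each kind and signer, but before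
  time \<open>E + F v\<close> no correct process has signed anything for a view above \<open>v\<close>.\<close>

lemma received_persists:
  assumes p: "p \<in> correct" and T: "T < E + F v" and m: "signer m \<in> correct" "msg_view m = v"
    and j: "ev j = Deliver q p m" and "Suc j \<le> k"
  shows "k \<le> horizon T \<Longrightarrow> m \<in> received (\<sigma> k p)"
proof -
  \<comment> \<open>Faulty processes may relay messages of \<open>signer m\<close>, so the argument
    rests on unforgeability, not on the link of delivery.\<close>
  have signed: "msg_view m' < v \<or> msg_view m' = v \<and> (kind m' = kind m \<longrightarrow> m' = m)"
    if i: "ev i = Deliver q' p m'" and i_lt: "i < horizon T" and sg: "signer m' = signer m" for i q' m'
  proof -
    obtain l r where l: "l < i" "actor (ev l) = Some (signer m)" "(r, m') \<in> sends (ev l) (\<sigma> l (signer m))"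
      using unforgeable[OF i signed_parts_self] sg m(1) by auto
    obtain l' r' where l': "actor (ev l') = Some (signer m)" "(r', m) \<in> sends (ev l') (\<sigma> l' (signer m))"
      using unforgeable[OF j signed_parts_self m(1)] by blast
    have "msg_view m' \<le> v"
      using sent_view(1)[OF l(2,3)] curr_view_le[OF m(1) T, of "Suc l"] l(1) i_lt by simp
    then show ?thesis
      using sent_unique[OF l(2,3) l'] m(2) v_gt_1 by fastforce
  qed
  show "k \<le> horizon T \<Longrightarrow> m \<in> received (\<sigma> k p)"
    using \<open>Suc j \<le> k\<close>
  proof (induction k rule: dec_induct)
    case base
    have "\<sigma> (Suc j) p = (\<sigma> j p)\<lparr>received := store m (\<sigma> j p)\<rparr>"
      using step[of j p] j by simp
    \<comment> \<open>A message that would keep \<open>m\<close> out of the buffer has the same kind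
      and signer and at least its view, hence is \<open>m\<close> itself.\<close>
    moreover have "m \<in> store m (\<sigma> j p)"
    proof -
      have "m' = m" if m': "m' \<in> received (\<sigma> j p)" "kind m' = kind m" "signer m' = signer m"
        "msg_view m \<le> msg_view m'" for m'
      proof -
        obtain i q' where "i < j" "ev i = Deliver q' p m'"
          using received_delivered[OF p m'(1)] by blast
        then show ?thesis
          using signed[of i q' m'] base m' m(2) by auto
      qed
      then show ?thesis
        by (auto simp: store_def Let_def)
    qed
    ultimately show ?case
      by simp
  next
    case (step k)
    have m_in: "m \<in> received (\<sigma> k p)"
      using step by simp
    from p show ?case
    proof (cases rule: local_step_cases[where k = k])
      case stutter
      then show ?thesis
        using m_in by simp
    next
      case act
      show ?thesis
      proof (cases "ev k")
        case (Deliver q' p' m')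
        then have "p' = p"
          using act by simp
        \<comment> \<open>Only a strictly higher view from the same signer could displace
          \<open>m\<close>.\<close>
        then have "signer m' = signer m \<Longrightarrow> msg_view m' \<le> v"
          using signed[of k q' m'] Deliver step.prems by auto
        then show ?thesis
          using act Deliver m_in m(2) by (auto simp: store_def Let_def)
      qed (use act m_in in \<open>auto split: msg.splits\<close>)
    qed
  qed
qed

text \<open>A correct sender of a message for \<open>v\<close> has already entered \<open>v\<close>,
  so it sends after \<open>GST\<close> and delivery is timely.\<close>

lemma received_at:
  assumes sent: "actor (ev k) = Some q" "(p, m) \<in> sends (ev k) (\<sigma> k q)"
    and p: "p \<in> correct" and view: "msg_view m = v"
    and T: "\<tau> k + \<delta> \<le> T" "T < E + F v"
  shows "m \<in> received (\<sigma> (horizon T) p)"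
proof -
  have q: "q \<in> correct"
    using actor_correct sent(1) .
  obtain i where "i < Suc k" "E \<le> \<tau> i"
    using in_view_time[OF q] sent_view(1)[OF sent] view by metis
  then have "GST \<le> \<tau> k"
    using GST_le_E monoD[OF time_mono, of i k] by simp
  then obtain j where j: "ev j = Deliver q p m" "\<tau> j \<le> \<tau> k + \<delta>"
    using timely[OF sent p] by blast
  then have "Suc j \<le> horizon T"
    using T less_horizon_iff[of j T] by simp
  then show ?thesis
    using received_persists[OF p T(2) _ view j(1)] sent_view(2)[OF sent] q by simp
qed

lemmas Ff_bound = long_enough Ff_nonneg[of v] delta_nonneg

subsection \<open>The proposal of a correct leader\<close>

text \<open>At the deadline the leader holds valid \<open>NEWLEADER\<close> messages from all
  correct processes. As \<open>Propose\<close> is not pending, its one condition that can fail is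
  \<open>\<not> proposed\<close>.\<close>

lemma leader_proposes:
  obtains j M x where "ev j = Propose (leader v) M x" and "curr_view (\<sigma> j (leader v)) = v"
    and "\<tau> j \<le> E + 3 * \<delta>"
proof -
  let ?L = "leader v" and ?T = "E + 3 * \<delta>"
  let ?s = "\<sigma> (horizon ?T) ?L"
  have T: "E + 2 * \<delta> \<le> ?T" "?T < E + F v"
    using Ff_bound by simp_all
  have view: "curr_view ?s = v"
    using curr_view_eq[OF leader_correct T] .
  have "\<exists>l. NEWLEADER l \<in> received ?s \<and> nl_signer l = q \<and> nl_view l = v \<and> valid_new_leader l"
    if q: "q \<in> correct" for q
  proof -
    obtain k where k: "ev k = NewView q v" "\<tau> k \<le> E + 2 * \<delta>"
      using entry[OF q] by blast
    let ?s' = "\<sigma> k q"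
    let ?l = "NewLeaderMsg q v (locked_view ?s') (prepared_val ?s') (cert ?s')
      (pre_view ?s') (curr_val ?s')"
    have "(?L, NEWLEADER ?l) \<in> sends (ev k) ?s'"
      using k v_gt_1 by simp
    then have "NEWLEADER ?l \<in> received ?s"
      using received_at[of k q ?L "NEWLEADER ?l" ?T] k T leader_correct by simp
    moreover have "valid_new_leader ?l"
      using wf_states[OF q, of k] NewView_increases[OF q k(1)]
      by (simp add: wf_state_def valid_new_leader_def)
    ultimately show ?thesis
      by force
  qed
  then obtain nl where nl: "\<And>q. q \<in> correct \<Longrightarrow> NEWLEADER (nl q) \<in> received ?s \<and>
      nl_signer (nl q) = q \<and> nl_view (nl q) = v \<and> valid_new_leader (nl q)"
    by metis
  \<comment> \<open>\<open>quorum\<close> demands exactly \<open>2 * f + 1\<close> members, whereas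
    there may be more correct processes.\<close>
  obtain Q where Q: "Q \<subseteq> correct" "card Q = 2 * f + 1"
    using obtain_subset_with_card_n[OF card_correct] by metis
  let ?M = "nl ` Q"
  have "bij_betw nl_signer ?M Q"
    by (rule bij_betw_byWitness[where f' = nl]) (use nl Q in \<open>auto simp: image_image\<close>)
  then have quorum: "newleader_quorum v ?M"
    unfolding newleader_quorum_def quorum_def using Q correct_procs nl by blast
  have "finite Q" "Q \<noteq> {}"
    using Q(2) card.infinite by fastforce+
  then obtain x where "leader_choice ?L ?M x"
    using ex_leader_choice[of ?M ?L] by auto
  moreover have "\<not> enabled (clk ?L ?T) ?s (Propose ?L ?M x)"
    using not_pending[OF leader_correct T(1)] unfolding pending_def by blast
  ultimately have "proposed ?s"
    using view quorum v_gt_1 nl Q(1) by auto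
  then obtain j M y where "j < horizon ?T" "ev j = Propose ?L M y" "curr_view (\<sigma> j ?L) = v"
    using proposed_event[OF leader_correct, of "horizon ?T"] unfolding view by blast
  then show ?thesis
    using that less_horizon_iff by simp
qed

text \<open>The slow choice is a relation, so the check is met with the very witnesses that the
  leader selected from \<open>M\<close>.\<close>

lemma leader_proposal_safe:
  assumes "ev j = Propose (leader v) M x" and "curr_view (\<sigma> j (leader v)) = v"
  shows "safe_proposal (PROPOSE (leader v) v x M)"
proof -
  have *: "NEWLEADER ` M \<subseteq> received (\<sigma> j (leader v))" "newleader_quorum v M"
    "leader_choice (leader v) M x"
    using step[of j "leader v"] assms by auto
  have "\<exists>y. x = Some y \<and> valid y"
    using leader_choice_valid[OF leader_correct *] .
  moreover obtain x_slow v_slow x_fast v_fast where "selection M x_slow v_slow x_fast v_fast"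
    "(v_slow \<ge> v_fast \<and> v_slow > 0 \<longrightarrow> x = x_slow) \<and> (v_slow < v_fast \<longrightarrow> x = x_fast)"
    using *(3) unfolding leader_choice_def by (auto split: if_splits)
  ultimately show ?thesis
    using *(2) unfolding safe_proposal.simps by blast
qed

subsection \<open>Voting, locking and deciding\<close>

text \<open>All stages share one pattern: by the deadline the inputs of a handler have arrived, and
  since it is not pending, its effect has already happened.\<close>

lemma all_decide:
  "\<exists>x. \<forall>p\<in>correct. (v, Some x) \<in> decisions (\<sigma> (horizon (E + 6 * \<delta> + Ff v)) p)"
proof -
  let ?L = "leader v"
  obtain j0 M x where j0: "ev j0 = Propose ?L M x" "curr_view (\<sigma> j0 ?L) = v"
    and t0: "\<tau> j0 \<le> E + 3 * \<delta>"
    using leader_proposes .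
  let ?m = "PROPOSE ?L v x M"
  have safe: "safe_proposal ?m"
    using leader_proposal_safe[OF j0] .
  then obtain y where y: "x = Some y"
    by auto
  have sent0: "actor (ev j0) = Some ?L" "r \<in> procs \<Longrightarrow> (r, ?m) \<in> sends (ev j0) (\<sigma> j0 ?L)" for r
    using j0 by (auto simp: to_all_def)

  \<comment> \<open>A vote requires a proposal signed by the leader, and by
    \<open>sent_unique\<close> the correct leader signs only one in this view.\<close>
  have voted_value: "curr_val (\<sigma> k p) = x"
    if p: "p \<in> correct" and k: "curr_view (\<sigma> k p) = v" "voted (\<sigma> k p) = Some True" for k p
  proof -
    obtain j i M' where j: "ev j = Vote p (PROPOSE i v (curr_val (\<sigma> k p)) M')"
      using voted_event[OF p k(2)] k(1) by blast
    let ?m' = "PROPOSE i v (curr_val (\<sigma> k p)) M'"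
    have rcvd: "?m' \<in> received (\<sigma> j p)" and "i = ?L"
      using step[of j p] j by auto
    then obtain l r where "actor (ev l) = Some ?L" "(r, ?m') \<in> sends (ev l) (\<sigma> l ?L)"
      using received_sent[OF p rcvd signed_parts_self] leader_correct by auto
    then have "?m' = ?m"
      using sent_unique[OF _ _ sent0, of l r ?m'] leader_correct correct_procs v_gt_1 by auto
    then show ?thesis
      by simp
  qed

  let ?T2 = "E + 4 * \<delta>"
  have T2: "E + 2 * \<delta> \<le> ?T2" "?T2 < E + F v" "\<tau> j0 + \<delta> \<le> ?T2"
    using Ff_bound t0 by simp_all
  have voted: "voted (\<sigma> (horizon ?T2) p) = Some True" if p: "p \<in> correct" for p
  proof -
    let ?s = "\<sigma> (horizon ?T2) p"
    have view: "curr_view ?s = v"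
      using curr_view_eq[OF p T2(1,2)] .
    have "?m \<in> received ?s"
      using received_at[OF sent0(1) sent0(2)] p correct_procs T2 by auto
    moreover have "\<not> enabled (clk p ?T2) ?s (Vote p ?m)"
      using not_pending[OF p T2(1)] unfolding pending_def by blast
    ultimately have "voted ?s \<noteq> Some False"
      using safe view by auto
    then show ?thesis
      using wf_states[OF p, of "horizon ?T2"] view v_gt_1 by (cases "voted ?s") (auto simp: wf_state_def)
  qed
  have vote_event: "\<exists>j i M'. ev j = Vote p (PROPOSE i v x M') \<and> \<tau> j \<le> ?T2"
    if p: "p \<in> correct" for p
  proof -
    let ?s = "\<sigma> (horizon ?T2) p"
    have view: "curr_view ?s = v"
      using curr_view_eq[OF p T2(1,2)] .
    then obtain j i M' where j: "j < horizon ?T2" "ev j = Vote p (PROPOSE i v x M')"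
      using voted_event[OF p voted[OF p]] voted_value[OF p view voted[OF p]] by auto
    then show ?thesis
      using less_horizon_iff by blast
  qed

  let ?T4 = "E + 5 * \<delta> + Ff v"
  have T4: "E + 2 * \<delta> \<le> ?T4" "?T4 < E + F v" "?T2 + \<delta> \<le> ?T4"
    using Ff_bound by simp_all
  have horizon_le: "horizon ?T2 \<le> horizon ?T4"
    using less_horizon_iff[of "horizon ?T4" ?T2] less_horizon_iff[of "horizon ?T4" ?T4] T4(3) Ff_bound
    by linarith
  have lock_event: "\<exists>j C. ev j = Lock p C \<and> curr_view (\<sigma> j p) = v \<and> \<tau> j \<le> ?T4"
    if p: "p \<in> correct" for p
  proof -
    let ?s = "\<sigma> (horizon ?T4) p"
    have view: "curr_view ?s = v"
      using curr_view_eq[OF p T4(1,2)] .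
    have voted': "voted ?s = Some True"
      using same_view_stable[OF p horizon_le] curr_view_eq[OF p T2(1,2)] view voted[OF p] by simp
    have val: "curr_val ?s = x"
      using voted_value[OF p view voted'] .
    \<comment> \<open>All correct votes at once; \<open>certifies\<close> admits more than
      \<open>2 * f + 1\<close> of them.\<close>
    let ?C = "{PreparedMsg j v (hash x) | j. j \<in> correct}"
    have "PREPARED (PreparedMsg q v (hash x)) \<in> received ?s" if q: "q \<in> correct" for q
    proof -
      obtain j i M' where j: "ev j = Vote q (PROPOSE i v x M')" "\<tau> j \<le> ?T2"
        using vote_event[OF q] by blast
      then show ?thesis
        using received_at[of j q p "PREPARED (PreparedMsg q v (hash x))" ?T4] p correct_procs T4
        by (auto simp: to_all_def)
    qed
    then have "PREPARED ` ?C \<subseteq> received ?s"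
      by auto
    moreover have "certifies ?C v (hash x)"
      unfolding certifies_def using correct_procs card_correct by blast
    moreover have "timer_expired (clk p ?T4) ?s"
    proof -
      obtain j i M' where j: "ev j = Vote p (PROPOSE i v x M')"
        and tm: "timer ?s = Some (clk p (\<tau> j) + Ff v)" and "j < horizon ?T4"
        using voted_event[OF p voted'] view val by auto
      have "curr_view (\<sigma> j p) = v" "voted (\<sigma> j p) = Some False"
        using step[of j p] j by auto
      obtain i' where "i' < j" "E \<le> \<tau> i'"
        using in_view_time[OF p \<open>curr_view (\<sigma> j p) = v\<close>] .
      then have ge: "GST \<le> \<tau> j"
        using monoD[OF time_mono, of i' j] GST_le_E by simp
      \<comment> \<open>The vote that set the timer is dated only by \<open>?T4\<close> so far. Had
        it come after \<open>?T2\<close>, the process would already have voted. So it was cast by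
        \<open>?T2\<close>, and as clocks do not drift after \<open>GST\<close>, the timer expires
        by \<open>?T4\<close>.\<close>
      have "\<not> horizon ?T2 \<le> j"
        using same_view_stable[OF p, of "horizon ?T2" j] curr_view_eq[OF p T2(1,2)] voted[OF p]
          \<open>curr_view (\<sigma> j p) = v\<close> \<open>voted (\<sigma> j p) = Some False\<close> by auto
      then have "\<tau> j \<le> ?T2"
        using less_horizon_iff[of j ?T2] by simp
      then show ?thesis
        using tm clock_after_GST[OF p ge, of ?T4] T4 ge Ff_bound by (simp add: timer_expired_def)
    qed
    ultimately have "enabled (clk p ?T4) ?s (Lock p ?C)"
      using view val voted' by simp
    then have "locked_view ?s = curr_view ?s"
      using not_pending[OF p T4(1)] unfolding pending_def by blast
    then show ?thesis
      using locked_event[OF p, of "horizon ?T4"] view v_gt_1 less_horizon_iff by auto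
  qed

  let ?T5 = "E + 6 * \<delta> + Ff v"
  have T5: "E + 2 * \<delta> \<le> ?T5" "?T5 < E + F v" "?T4 + \<delta> \<le> ?T5"
    using Ff_bound by simp_all
  have "(v, Some y) \<in> decisions (\<sigma> (horizon ?T5) p)" if p: "p \<in> correct" for p
  proof -
    let ?s = "\<sigma> (horizon ?T5) p"
    have view: "curr_view ?s = v"
      using curr_view_eq[OF p T5(1,2)] .
    obtain j C where j: "ev j = Lock p C" "curr_view (\<sigma> j p) = v" "\<tau> j \<le> ?T4"
      using lock_event[OF p] by blast
    have "Suc j \<le> horizon ?T5"
      using j(3) T5(3) Ff_bound less_horizon_iff[of j ?T5] by simp
    moreover have after: "curr_view (\<sigma> (Suc j) p) = v" "locked_view (\<sigma> (Suc j) p) = v"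
      "voted (\<sigma> (Suc j) p) = Some True"
      using step[of j p] j by auto
    ultimately have voted': "voted ?s = Some True" and "locked_view ?s = v"
      using same_view_stable[OF p, of "Suc j" "horizon ?T5"] view by auto
    have val: "curr_val ?s = x"
      using voted_value[OF p view voted'] .
    have "COMMITTED q v (hash x) \<in> received ?s" if q: "q \<in> correct" for q
    proof -
      obtain j C where j: "ev j = Lock q C" "curr_view (\<sigma> j q) = v" "\<tau> j \<le> ?T4"
        using lock_event[OF q] by blast
      moreover have "curr_val (\<sigma> j q) = x"
        using voted_value[OF q j(2)] step[of j q] j by auto
      ultimately show ?thesis
        using received_at[of j q p "COMMITTED q v (hash x)" ?T5] p correct_procs T5
        by (auto simp: to_all_def)
    qed
    moreover obtain Q where "Q \<subseteq> correct" "card Q = 2 * f + 1"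
      using obtain_subset_with_card_n[OF card_correct] by metis
    ultimately have "enabled (clk p ?T5) ?s (SlowDecide p)"
      using view val \<open>locked_view ?s = v\<close> correct_procs by (auto simp: quorum_def)
    \<comment> \<open>An enabled but not pending \<open>SlowDecide\<close> means that this value is
      already recorded, by either path.\<close>
    then show ?thesis
      using not_pending[OF p T5(1)] view val y unfolding pending_def by auto
  qed
  then show ?thesis
    by blast
qed

end

theorem corollary63:
  fixes f :: nat
    and valid :: "'v \<Rightarrow> bool"
    and myval :: "proc \<Rightarrow> 'v"
    and hash :: "'v option \<Rightarrow> 'h"
    and F Ff :: "nat \<Rightarrow> real"
    and correct :: "proc set"
    and GST \<delta> :: real
    and clk :: "proc \<Rightarrow> real \<Rightarrow> real"
    and \<tau> :: "nat \<Rightarrow> real"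
    and ev :: "nat \<Rightarrow> ('v, 'h) event"
    and \<sigma> :: "nat \<Rightarrow> proc \<Rightarrow> ('v, 'h) local_state"
    and \<V> :: view
  assumes "sbft_execution f valid myval hash Ff correct GST \<delta> clk \<tau> ev \<sigma>"
    and "synchronizer correct GST \<tau> ev F \<V> (2 * \<delta>)"
    and "\<forall>\<theta>. \<exists>v. \<forall>v'\<ge>v. F v' > \<theta> \<and> Ff v' > \<theta> \<and> F v' - Ff v' > \<theta>"
  shows "\<forall>p\<in>correct. \<exists>k v x. (v, Some x) \<in> decisions (\<sigma> k p)"
proof -
  interpret sbft_run f valid myval hash Ff correct GST \<delta> clk \<tau> ev \<sigma> F \<V>
    using assms(1,2) by (rule sbft_run.intro)
  \<comment> \<open>The slack \<open>6 * \<delta>\<close> is \<open>2 * \<delta>\<close> for the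
    spread of entries plus one delay for each of the four message kinds.\<close>
  obtain v\<^sub>0 where v\<^sub>0: "\<And>v. v\<^sub>0 \<le> v \<Longrightarrow> 6 * \<delta> < F v - Ff v"
    using assms(3) by blast
  \<comment> \<open>The bounds provide the slack, the synchronizer guarantees, and a view other than
    the special view 1.\<close>
  obtain v where v: "max (max v\<^sub>0 \<V>) 2 \<le> v" and "leader v \<in> correct"
    using ex_correct_leader by blast
  then interpret good_view f valid myval hash Ff correct GST \<delta> clk \<tau> ev \<sigma> F \<V> v
    using v\<^sub>0[of v] by unfold_locales auto
  show ?thesis
    using all_decide by blast
qed

end
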